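(* Let $(L,[\cdot,\cdot,\cdot],\alpha,\beta)$ be a $3$-Bihom-Lie algebra over a field $\mathbb{K}$. Then there is a strong abelian product structure on $L$ if and only if $L=L_+\oplus L_-$ (direct sum of vector spaces), where $L_+$ and $L_-$ are abelian Bihom subalgebras of $L$ such that $[L_+,L_+,L_-]\subseteq L_+$, $[L_+,L_-,L_+]\subseteq L_+$, $[L_-,L_+,L_+]\subseteq L_+$, $[L_-,L_+,L_-]\subseteq L_-$, $[L_+,L_-,L_-]\subseteq L_-$ and $[L_-,L_-,L_+]\subseteq L_-$.
   Context: A $3$-Bihom-Lie algebra over a field $\mathbb{K}$ is a $4$-tuple $(L,[\cdot,\cdot,\cdot],\alpha,\beta)$ consisting of a $\mathbb{K}$-vector space $L$, a $3$-linear map $[\cdot,\cdot,\cdot]\colon L\times L\times L\to L$ and two linear maps $\alpha,\beta\colon L\to L$ such that for all $x,y,z,u,v\in L$: (1) $\alpha\beta=\beta\alpha$; (2) $\alpha([x,y,z])=[\alpha(x),\alpha(y),\alpha(z)]$ and $\beta([x,y,z])=[\beta(x),\beta(y),\beta(z)]$; (3) $[\beta(x),\beta(y),\alpha(z)]=-[\beta(y),\beta(x),\alpha(z)]=-[\beta(x),\beta(z),\alpha(y)]$; (4) $[\beta^2(u),\beta^2(v),[\beta(x),\beta(y),\alpha(z)]]=[\beta^2(y),\beta^2(z),[\beta(u),\beta(v),\alpha(x)]]-[\beta^2(x),\beta^2(z),[\beta(u),\beta(v),\alpha(y)]]+[\beta^2(x),\beta^2(y),[\beta(u),\beta(v),\alpha(z)]]$.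 A linear subspace $\eta\subseteq L$ is a Bihom subalgebra if $\alpha(\eta)\subseteq\eta$, $\beta(\eta)\subseteq\eta$ and $[x,y,z]\in\eta$ for all $x,y,z\in\eta$. A Bihom subalgebra $\eta$ is abelian if $[x,y,z]=0$ for all $x,y,z\in\eta$. An almost product structure on $L$ is a linear map $E\colon L\to L$ with $E^2=\mathrm{Id}$, $E\neq\pm\mathrm{Id}$, $\alpha E=E\alpha$ and $\beta E=E\beta$. An almost product structure $E$ is called a strong abelian product structure if $[x,y,z]=E[Ex,y,z]+E[x,Ey,z]+E[x,y,Ez]$ for all $x,y,z\in L$. For subspaces $A,B,C\subseteq L$, $[A,B,C]$ denotes the span of all $[a,b,c]$ with $a\in A$, $b\in B$, $c\in C$.
   Formalization: The field is assumed to have characteristic different from 2, and both L_+ and L_- are required to be nonzero; without these conditions the stated equivalence is false (e.g. L one-dimensional with zero bracket, L_+ = L, L_- = 0). *)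

theory Defs
  imports Complex_Main
begin

text \<open>The underlying vector space is the whole type \<open>'v\<close>, with scalar multiplication \<open>scale\<close>
  over the field \<open>'k\<close>.\<close>

definition trilinear ::
    "('k::field \<Rightarrow> 'v::ab_group_add \<Rightarrow> 'v) \<Rightarrow> ('v \<Rightarrow> 'v \<Rightarrow> 'v \<Rightarrow> 'v) \<Rightarrow> bool" where
  "trilinear scale br \<longleftrightarrow>
     (\<forall>y z. Vector_Spaces.linear scale scale (\<lambda>x. br x y z)) \<and>
     (\<forall>x z. Vector_Spaces.linear scale scale (\<lambda>y. br x y z)) \<and>
     (\<forall>x y. Vector_Spaces.linear scale scale (\<lambda>z. br x y z))"

locale three_bihom_lie_algebra = vector_space scale
  for scale :: "'k::field \<Rightarrow> 'v::ab_group_add \<Rightarrow> 'v" +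
  fixes br :: "'v \<Rightarrow> 'v \<Rightarrow> 'v \<Rightarrow> 'v"
    and \<alpha> \<beta> :: "'v \<Rightarrow> 'v"
  assumes trilinear_br: "trilinear scale br"
    and linear_\<alpha>: "Vector_Spaces.linear scale scale \<alpha>"
    and linear_\<beta>: "Vector_Spaces.linear scale scale \<beta>"
    and \<alpha>_\<beta>_commute: "\<alpha> \<circ> \<beta> = \<beta> \<circ> \<alpha>"
    and \<alpha>_br: "\<alpha> (br x y z) = br (\<alpha> x) (\<alpha> y) (\<alpha> z)"
    and \<beta>_br: "\<beta> (br x y z) = br (\<beta> x) (\<beta> y) (\<beta> z)"
    and skew_12: "br (\<beta> x) (\<beta> y) (\<alpha> z) = - br (\<beta> y) (\<beta> x) (\<alpha> z)"
    and skew_23: "br (\<beta> x) (\<beta> y) (\<alpha> z) = - br (\<beta> x) (\<beta> z) (\<alpha> y)"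
    and bihom_jacobi:
      "br (\<beta> (\<beta> u)) (\<beta> (\<beta> v)) (br (\<beta> x) (\<beta> y) (\<alpha> z)) =
         br (\<beta> (\<beta> y)) (\<beta> (\<beta> z)) (br (\<beta> u) (\<beta> v) (\<alpha> x))
       - br (\<beta> (\<beta> x)) (\<beta> (\<beta> z)) (br (\<beta> u) (\<beta> v) (\<alpha> y))
       + br (\<beta> (\<beta> x)) (\<beta> (\<beta> y)) (br (\<beta> u) (\<beta> v) (\<alpha> z))"

definition bihom_subalgebra ::
    "('k::field \<Rightarrow> 'v::ab_group_add \<Rightarrow> 'v) \<Rightarrow> ('v \<Rightarrow> 'v \<Rightarrow> 'v \<Rightarrow> 'v) \<Rightarrow>
     ('v \<Rightarrow> 'v) \<Rightarrow> ('v \<Rightarrow> 'v) \<Rightarrow> 'v set \<Rightarrow> bool" where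
  "bihom_subalgebra scale br \<alpha> \<beta> \<eta> \<longleftrightarrow>
     module.subspace scale \<eta> \<and> \<alpha> ` \<eta> \<subseteq> \<eta> \<and> \<beta> ` \<eta> \<subseteq> \<eta> \<and>
     (\<forall>x\<in>\<eta>. \<forall>y\<in>\<eta>. \<forall>z\<in>\<eta>. br x y z \<in> \<eta>)"

definition abelian_bihom_subalgebra ::
    "('k::field \<Rightarrow> 'v::ab_group_add \<Rightarrow> 'v) \<Rightarrow> ('v \<Rightarrow> 'v \<Rightarrow> 'v \<Rightarrow> 'v) \<Rightarrow>
     ('v \<Rightarrow> 'v) \<Rightarrow> ('v \<Rightarrow> 'v) \<Rightarrow> 'v set \<Rightarrow> bool" where
  "abelian_bihom_subalgebra scale br \<alpha> \<beta> \<eta> \<longleftrightarrow>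
     bihom_subalgebra scale br \<alpha> \<beta> \<eta> \<and> (\<forall>x\<in>\<eta>. \<forall>y\<in>\<eta>. \<forall>z\<in>\<eta>. br x y z = 0)"

definition almost_product_structure ::
    "('k::field \<Rightarrow> 'v::ab_group_add \<Rightarrow> 'v) \<Rightarrow> ('v \<Rightarrow> 'v) \<Rightarrow> ('v \<Rightarrow> 'v) \<Rightarrow>
     ('v \<Rightarrow> 'v) \<Rightarrow> bool" where
  "almost_product_structure scale \<alpha> \<beta> E \<longleftrightarrow>
     Vector_Spaces.linear scale scale E \<and> E \<circ> E = id \<and> E \<noteq> id \<and> E \<noteq> (\<lambda>x. - x) \<and>
     \<alpha> \<circ> E = E \<circ> \<alpha> \<and> \<beta> \<circ> E = E \<circ> \<beta>"

definition strong_abelian_product_structure ::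
    "('k::field \<Rightarrow> 'v::ab_group_add \<Rightarrow> 'v) \<Rightarrow> ('v \<Rightarrow> 'v \<Rightarrow> 'v \<Rightarrow> 'v) \<Rightarrow>
     ('v \<Rightarrow> 'v) \<Rightarrow> ('v \<Rightarrow> 'v) \<Rightarrow> ('v \<Rightarrow> 'v) \<Rightarrow> bool" where
  "strong_abelian_product_structure scale br \<alpha> \<beta> E \<longleftrightarrow>
     almost_product_structure scale \<alpha> \<beta> E \<and>
     (\<forall>x y z. br x y z = E (br (E x) y z) + E (br x (E y) z) + E (br x y (E z)))"

definition bracket_span ::
    "('k::field \<Rightarrow> 'v::ab_group_add \<Rightarrow> 'v) \<Rightarrow> ('v \<Rightarrow> 'v \<Rightarrow> 'v \<Rightarrow> 'v) \<Rightarrow>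
     'v set \<Rightarrow> 'v set \<Rightarrow> 'v set \<Rightarrow> 'v set" where
  "bracket_span scale br A B C = module.span scale {br a b c | a b c. a \<in> A \<and> b \<in> B \<and> c \<in> C}"

definition direct_sum_decomposition ::
    "('k::field \<Rightarrow> 'v::ab_group_add \<Rightarrow> 'v) \<Rightarrow> 'v set \<Rightarrow> 'v set \<Rightarrow> bool" where
  "direct_sum_decomposition scale A B \<longleftrightarrow>
     module.subspace scale A \<and> module.subspace scale B \<and>
     A \<inter> B = {0} \<and> {a + b | a b. a \<in> A \<and> b \<in> B} = UNIV"

end

theory Submission
  imports Defs
begin

text \<open>A strong abelian product structure \<open>E\<close> corresponds to the pair of its eigenspaces for \<open>1\<close>
  and \<open>-1\<close>. On arguments which are eigenvectors with eigenvalues \<open>p, q, r \<in> {1, -1}\<close>, the defining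
  identity reads \<open>w = (p + q + r) E w\<close> for the bracket \<open>w\<close>. If the three signs agree, then
  \<open>w = 9 w\<close>, so \<open>w = 0\<close> as \<open>8 \<noteq> 0\<close>; otherwise \<open>p + q + r\<close> is the majority sign, and the identity
  says that \<open>w\<close> lies in the eigenspace of that sign.\<close>

section \<open>Involutions, direct sums and spans of brackets\<close>

context vector_space
begin

lemmas linear_hom_add = module_hom_linearI[THEN module_hom.add]
lemmas linear_hom_diff = module_hom_linearI[THEN module_hom.diff]
lemmas linear_hom_neg = module_hom_linearI[THEN module_hom.neg]
lemmas linear_hom_scale = module_hom_linearI[THEN module_hom.scale]
lemmas linear_hom_zero = module_hom_linearI[THEN module_hom.zero]

text \<open>\<open>x + x\<close> is \<open>scale 2 x\<close>, and a nonzero scalar annihilates only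
  \<open>0\<close>. The form with sums allows repeated doublings to be rewritten away.\<close>

lemma add_self_eq_0_iff:
  fixes x :: 'b
  assumes "(2::'a) \<noteq> 0"
  shows "x + x = 0 \<longleftrightarrow> x = 0"
proof -
  have "x + x = scale 2 x"
    using scale_left_distrib[of 1 1 x] by (simp add: one_add_one)
  with assms show ?thesis by simp
qed

lemma eq_uminus_iff_eq_0:
  fixes x :: 'b
  assumes "(2::'a) \<noteq> 0"
  shows "x = - x \<longleftrightarrow> x = 0"
  using add_self_eq_0_iff[OF assms, of x] by (simp add: eq_neg_iff_add_eq_0)

lemma subspace_eigenspaces_pm_one:
  assumes "Vector_Spaces.linear scale scale E"
  shows "subspace {x. E x = x}" and "subspace {x. E x = - x}"
  by (simp_all add: subspace_def linear_hom_zero[OF assms] linear_hom_add[OF assms] linear_hom_scale[OF assms])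

text \<open>The components of \<open>x\<close> are the halves of \<open>x + E x\<close> and
  \<open>x - E x\<close>: since \<open>E (E x) = x\<close>, the map \<open>E\<close> fixes the first
  and negates the second. A vector in both eigenspaces equals its own negative, hence
  vanishes.\<close>

lemma involution_direct_sum:
  assumes two: "(2::'a) \<noteq> 0"
    and lin: "Vector_Spaces.linear scale scale E" and inv: "\<And>x. E (E x) = x"
  shows "direct_sum_decomposition scale {x. E x = x} {x. E x = - x}"
proof -
  have "\<exists>a b. x = a + b \<and> E a = a \<and> E b = - b" for x
  proof (intro exI conjI)
    let ?h = "\<lambda>v. scale (1/2) v"
    have half: "?h v + ?h v = v" for v
      using scale_left_distrib[of "1/2" "1/2" v] two by (simp flip: add_divide_distrib)
    show "x = ?h (x + E x) + ?h (x - E x)"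
      using half by (simp add: scale_right_distrib scale_right_diff_distrib)
    show "E (?h (x + E x)) = ?h (x + E x)"
      using linear_hom_add[OF lin] linear_hom_scale[OF lin] inv by (simp add: add.commute)
    show "E (?h (x - E x)) = - ?h (x - E x)"
      using linear_hom_diff[OF lin] linear_hom_scale[OF lin] inv by (simp flip: scale_minus_right)
  qed
  then have "{a + b | a b. a \<in> {x. E x = x} \<and> b \<in> {x. E x = - x}} = UNIV"
    by blast
  moreover have "{x. E x = x} \<inter> {x. E x = - x} = {0}"
  proof -
    have "x = 0" if "E x = x" "E x = - x" for x
      using trans[OF that(1)[symmetric] that(2)] by (rule iffD1[OF eq_uminus_iff_eq_0[OF two]])
    moreover have "E 0 = 0" "E 0 = - 0" using linear_hom_zero[OF lin] by simp_all
    ultimately show ?thesis by blast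
  qed
  ultimately show ?thesis
    using subspace_eigenspaces_pm_one[OF lin] by (simp add: direct_sum_decomposition_def)
qed

lemma direct_sum_unique:
  assumes "direct_sum_decomposition scale A B"
    and "a \<in> A" "b \<in> B" "a' \<in> A" "b' \<in> B" "a + b = a' + b'"
  shows "a = a'" and "b = b'"
proof -
  have "a - a' = b' - b" using assms(6) by (simp add: algebra_simps)
  moreover have "a - a' \<in> A" "b' - b \<in> B"
    using assms by (auto simp: direct_sum_decomposition_def intro: subspace_diff)
  ultimately have "a - a' \<in> A \<inter> B" by simp
  then have "a - a' = 0" using assms(1) unfolding direct_sum_decomposition_def by blast
  then show "a = a'" by simp
  then show "b = b'" using assms(6) by simp
qed

lemma direct_sum_obtain:
  assumes "direct_sum_decomposition scale A B"
  obtains a b where "a \<in> A" "b \<in> B" "x = a + b"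
proof -
  have "x \<in> {a + b | a b. a \<in> A \<and> b \<in> B}"
    using assms by (simp add: direct_sum_decomposition_def)
  then show thesis using that by blast
qed

text \<open>Supplies the candidate structure for the converse direction. It is well defined because
  components are unique, and linear because \<open>A\<close> and \<open>B\<close> are closed under
  sums and scalar multiples.\<close>

lemma direct_sum_reflection:
  assumes ds: "direct_sum_decomposition scale A B"
  obtains E where "Vector_Spaces.linear scale scale E" "\<And>a b. a \<in> A \<Longrightarrow> b \<in> B \<Longrightarrow> E (a + b) = a - b"
proof -
  note unique = direct_sum_unique[OF ds]
  define E where "E x = (THE y. \<exists>a\<in>A. \<exists>b\<in>B. x = a + b \<and> y = a - b)" for x
  have E: "E (a + b) = a - b" if "a \<in> A" "b \<in> B" for a b
    unfolding E_def
  proof (rule the_equality)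
    show "\<exists>a'\<in>A. \<exists>b'\<in>B. a + b = a' + b' \<and> a - b = a' - b'" using that by blast
    show "y = a - b" if "\<exists>a'\<in>A. \<exists>b'\<in>B. a + b = a' + b' \<and> y = a' - b'" for y
      using that unique[OF \<open>a \<in> A\<close> \<open>b \<in> B\<close>] by blast
  qed
  have sub: "subspace A" "subspace B" using ds by (auto simp: direct_sum_decomposition_def)
  have "E (x + y) = E x + E y" for x y
  proof -
    obtain a b where x: "a \<in> A" "b \<in> B" "x = a + b" by (rule direct_sum_obtain[OF ds])
    obtain c d where y: "c \<in> A" "d \<in> B" "y = c + d" by (rule direct_sum_obtain[OF ds])
    have "x + y = (a + c) + (b + d)" using x y by (simp add: algebra_simps)
    also have "E \<dots> = (a + c) - (b + d)"
      using x y by (intro E subspace_add sub)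
    also have "\<dots> = E x + E y" using x y by (simp add: E)
    finally show ?thesis .
  qed
  moreover have "E (scale k x) = scale k (E x)" for k x
  proof -
    obtain a b where x: "a \<in> A" "b \<in> B" "x = a + b" by (rule direct_sum_obtain[OF ds])
    show ?thesis
      using E[of "scale k a" "scale k b"] E[of a b] x subspace_scale[OF sub(1)] subspace_scale[OF sub(2)]
      by (simp add: scale_right_distrib scale_right_diff_distrib)
  qed
  ultimately have "Vector_Spaces.linear scale scale E"
    by (simp add: Vector_Spaces.linear_iff vector_space_axioms)
  with E that show thesis by blast
qed

text \<open>Applying \<open>E\<close> to the hypothesis gives \<open>E w = 3 w\<close>; inserting
  this back gives \<open>9 w = w\<close>. This settles brackets whose three arguments have the same
  sign.\<close>

lemma eq_thrice_involution_imp_0: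
  assumes two: "(2::'a) \<noteq> 0"
    and lin: "Vector_Spaces.linear scale scale E" and inv: "\<And>x. E (E x) = x"
    and w: "E w + E w + E w = w"
  shows "w = 0"
proof -
  have Ew: "E w = w + w + w"
    using arg_cong[OF w, of E, symmetric] by (simp add: linear_hom_add[OF lin] inv)
  have "(w + w + w) + (w + w + w) + (w + w + w) = w"
    using w unfolding Ew .
  \<comment> \<open>The vector \<open>8 w\<close> is nested as three successive doublings, each of
    which \<open>add_self_eq_0_iff\<close> removes.\<close>
  then have "((w + w) + (w + w)) + ((w + w) + (w + w)) = 0"
    by (simp add: algebra_simps)
  then show ?thesis by (simp only: add_self_eq_0_iff[OF two])
qed

text \<open>A subspace contains a span exactly when it contains the generators, so all six
  inclusions can be treated on single brackets.\<close>

lemma bracket_span_subset_iff: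
  assumes "subspace S"
  shows "bracket_span scale br A B C \<subseteq> S \<longleftrightarrow> (\<forall>a\<in>A. \<forall>b\<in>B. \<forall>c\<in>C. br a b c \<in> S)"
proof
  assume *: "bracket_span scale br A B C \<subseteq> S"
  have "br a b c \<in> bracket_span scale br A B C" if "a \<in> A" "b \<in> B" "c \<in> C" for a b c
    unfolding bracket_span_def
  proof (rule span_base)
    show "br a b c \<in> {br a b c | a b c. a \<in> A \<and> b \<in> B \<and> c \<in> C}"
      using that by blast
  qed
  with * show "\<forall>a\<in>A. \<forall>b\<in>B. \<forall>c\<in>C. br a b c \<in> S" by blast
next
  assume *: "\<forall>a\<in>A. \<forall>b\<in>B. \<forall>c\<in>C. br a b c \<in> S"
  show "bracket_span scale br A B C \<subseteq> S"
    unfolding bracket_span_def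
  proof (rule span_minimal)
    show "{br a b c | a b c. a \<in> A \<and> b \<in> B \<and> c \<in> C} \<subseteq> S"
      using * by clarsimp
  qed fact
qed

end

section \<open>Brackets of eigenvectors\<close>

context three_bihom_lie_algebra
begin

lemma br_add:
  "br (x + x') y z = br x y z + br x' y z"
  "br x (y + y') z = br x y z + br x y' z"
  "br x y (z + z') = br x y z + br x y z'"
  using trilinear_br by (simp_all add: trilinear_def Vector_Spaces.linear_iff)

lemma br_uminus:
  "br (- x) y z = - br x y z"
  "br x (- y) z = - br x y z"
  "br x y (- z) = - br x y z"
proof -
  have "Vector_Spaces.linear scale scale (\<lambda>x. br x y z)"
    "Vector_Spaces.linear scale scale (\<lambda>y. br x y z)"
    "Vector_Spaces.linear scale scale (\<lambda>z. br x y z)"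
    using trilinear_br by (simp_all add: trilinear_def)
  from this[THEN linear_hom_neg]
  show "br (- x) y z = - br x y z" "br x (- y) z = - br x y z" "br x y (- z) = - br x y z"
    by blast+
qed

lemma br_diff:
  "br (x - x') y z = br x y z - br x' y z"
  "br x (y - y') z = br x y z - br x y' z"
  "br x y (z - z') = br x y z - br x y z'"
  by (simp_all only: diff_conv_add_uminus br_add br_uminus)

lemma strong_abelian_product_structure_imp_decomposition:
  assumes two: "(2::'k) \<noteq> 0"
    and str: "strong_abelian_product_structure scale br \<alpha> \<beta> E"
  defines "Lp \<equiv> {x. E x = x}" and "Lm \<equiv> {x. E x = - x}"
  shows "direct_sum_decomposition scale Lp Lm" "Lp \<noteq> {0}" "Lm \<noteq> {0}"
    "abelian_bihom_subalgebra scale br \<alpha> \<beta> Lp"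
    "abelian_bihom_subalgebra scale br \<alpha> \<beta> Lm"
    "bracket_span scale br Lp Lp Lm \<subseteq> Lp" "bracket_span scale br Lp Lm Lp \<subseteq> Lp"
    "bracket_span scale br Lm Lp Lp \<subseteq> Lp" "bracket_span scale br Lm Lp Lm \<subseteq> Lm"
    "bracket_span scale br Lp Lm Lm \<subseteq> Lm" "bracket_span scale br Lm Lm Lp \<subseteq> Lm"
proof -
  have lin: "Vector_Spaces.linear scale scale E" and inv: "E (E x) = x"
    and not_id: "E \<noteq> id" "E \<noteq> (\<lambda>x. - x)"
    and \<alpha>E: "\<alpha> (E x) = E (\<alpha> x)" and \<beta>E: "\<beta> (E x) = E (\<beta> x)"
    and id: "E (br (E x) y z) + E (br x (E y) z) + E (br x y (E z)) = br x y z" for x y z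
    using str unfolding strong_abelian_product_structure_def almost_product_structure_def
    by (metis comp_apply id_apply)+
  note neg = linear_hom_neg[OF lin]
  show ds: "direct_sum_decomposition scale Lp Lm"
    unfolding Lp_def Lm_def by (rule involution_direct_sum[OF two lin inv])
  then have sub: "subspace Lp" "subspace Lm" by (auto simp: direct_sum_decomposition_def)
  \<comment> \<open>A vector not fixed by \<open>E\<close> yields the nonzero element
    \<open>E x - x\<close> of \<open>Lm\<close>; likewise, one not negated yields
    \<open>E x + x\<close> in \<open>Lp\<close>.\<close>
  from not_id(1) obtain x where "E x \<noteq> x" by (auto simp: fun_eq_iff)
  moreover have "E x - x \<in> Lm" by (simp add: Lm_def linear_hom_diff[OF lin] inv)
  ultimately show "Lm \<noteq> {0}" by auto
  from not_id(2) obtain x where "E x \<noteq> - x" by (auto simp: fun_eq_iff)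
  then have "E x + x \<noteq> 0" by (simp add: eq_neg_iff_add_eq_0)
  moreover have "E x + x \<in> Lp" by (simp add: Lp_def linear_hom_add[OF lin] inv add.commute)
  ultimately show "Lp \<noteq> {0}" by auto
  have ppp: "br x y z = 0" if "x \<in> Lp" "y \<in> Lp" "z \<in> Lp" for x y z
    using id[of x y z] that
    by (intro eq_thrice_involution_imp_0[OF two lin inv]) (simp add: Lp_def)
  have mmm: "br x y z = 0" if "x \<in> Lm" "y \<in> Lm" "z \<in> Lm" for x y z
  proof -
    let ?w = "br x y z"
    have w: "- E ?w + - E ?w + - E ?w = ?w"
      using id[of x y z] that by (simp add: Lm_def br_uminus neg)
    \<comment> \<open>The negative of \<open>E\<close> is again a linear involution, so the argument
      for three plus signs applies to it.\<close>
    have "Vector_Spaces.linear scale scale (\<lambda>x. - E x)"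
      using lin by (simp add: Vector_Spaces.linear_iff)
    from eq_thrice_involution_imp_0[OF two this, of ?w] w show ?thesis
      by (simp add: neg inv)
  qed
  have "\<alpha> ` Lp \<subseteq> Lp" "\<beta> ` Lp \<subseteq> Lp"
    by (auto simp: Lp_def simp flip: \<alpha>E \<beta>E)
  \<comment> \<open>Closure under the bracket follows from its vanishing, as a subspace contains
    \<open>0\<close>.\<close>
  then show "abelian_bihom_subalgebra scale br \<alpha> \<beta> Lp"
    using ppp sub subspace_0[OF sub(1)]
    by (simp add: abelian_bihom_subalgebra_def bihom_subalgebra_def)
  have "\<alpha> ` Lm \<subseteq> Lm" "\<beta> ` Lm \<subseteq> Lm"
    using linear_hom_neg[OF linear_\<alpha>] linear_hom_neg[OF linear_\<beta>]
    by (auto simp: Lm_def simp flip: \<alpha>E \<beta>E)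
  then show "abelian_bihom_subalgebra scale br \<alpha> \<beta> Lm"
    using mmm sub subspace_0[OF sub(2)]
    by (simp add: abelian_bihom_subalgebra_def bihom_subalgebra_def)
  \<comment> \<open>With one minus sign two of the three terms cancel, leaving
    \<open>E w = w\<close> for the bracket \<open>w\<close>; with two minus signs what remains below
    is \<open>- E w = w\<close>.\<close>
  have "br x y z \<in> Lp"
    if "x \<in> Lp \<and> y \<in> Lp \<and> z \<in> Lm \<or> x \<in> Lp \<and> y \<in> Lm \<and> z \<in> Lp \<or> x \<in> Lm \<and> y \<in> Lp \<and> z \<in> Lp" for x y z
    using id[of x y z] that by (elim disjE) (simp_all add: Lp_def Lm_def br_uminus neg)
  then show "bracket_span scale br Lp Lp Lm \<subseteq> Lp" "bracket_span scale br Lp Lm Lp \<subseteq> Lp"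
    "bracket_span scale br Lm Lp Lp \<subseteq> Lp"
    by (simp_all add: bracket_span_subset_iff sub)
  have "br x y z \<in> Lm"
    if "x \<in> Lm \<and> y \<in> Lp \<and> z \<in> Lm \<or> x \<in> Lp \<and> y \<in> Lm \<and> z \<in> Lm \<or> x \<in> Lm \<and> y \<in> Lm \<and> z \<in> Lp" for x y z
  proof -
    have "- E (br x y z) = br x y z"
      using id[of x y z] that by (elim disjE) (simp_all add: Lp_def Lm_def br_uminus neg)
    from iffD1[OF equation_minus_iff, OF this[symmetric]] show ?thesis
      unfolding Lm_def ..
  qed
  then show "bracket_span scale br Lm Lp Lm \<subseteq> Lm" "bracket_span scale br Lp Lm Lm \<subseteq> Lm"
    "bracket_span scale br Lm Lm Lp \<subseteq> Lm"
    by (simp_all add: bracket_span_subset_iff sub)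
qed

text \<open>The structure is the reflection equal to \<open>1\<close> on \<open>Lp\<close> and
  \<open>-1\<close> on \<open>Lm\<close>. Its defining identity is trilinear, so it need only hold
  on arguments from the two summands.\<close>

lemma decomposition_imp_strong_abelian_product_structure:
  assumes two: "(2::'k) \<noteq> 0"
    and ds: "direct_sum_decomposition scale Lp Lm" and nz: "Lp \<noteq> {0}" "Lm \<noteq> {0}"
    and ab: "abelian_bihom_subalgebra scale br \<alpha> \<beta> Lp" "abelian_bihom_subalgebra scale br \<alpha> \<beta> Lm"
    and incl: "bracket_span scale br Lp Lp Lm \<subseteq> Lp" "bracket_span scale br Lp Lm Lp \<subseteq> Lp"
      "bracket_span scale br Lm Lp Lp \<subseteq> Lp" "bracket_span scale br Lm Lp Lm \<subseteq> Lm"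
      "bracket_span scale br Lp Lm Lm \<subseteq> Lm" "bracket_span scale br Lm Lm Lp \<subseteq> Lm"
  shows "\<exists>E. strong_abelian_product_structure scale br \<alpha> \<beta> E"
proof -
  obtain E where lin: "Vector_Spaces.linear scale scale E"
    and E: "\<And>a b. a \<in> Lp \<Longrightarrow> b \<in> Lm \<Longrightarrow> E (a + b) = a - b"
    using direct_sum_reflection[OF ds] by blast
  have sub: "subspace Lp" "subspace Lm" using ds by (auto simp: direct_sum_decomposition_def)
  note zero = subspace_0[OF sub(1)] subspace_0[OF sub(2)]
  have Ep: "E a = a" if "a \<in> Lp" for a using E[OF that zero(2)] by simp
  have Em: "E b = - b" if "b \<in> Lm" for b using E[OF zero(1) that] by simp
  note E_hom = linear_hom_add[OF lin] linear_hom_diff[OF lin] linear_hom_neg[OF lin] linear_hom_zero[OF lin]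
  have closed: "a \<in> Lp \<Longrightarrow> \<alpha> a \<in> Lp" "a \<in> Lp \<Longrightarrow> \<beta> a \<in> Lp"
    "a \<in> Lm \<Longrightarrow> \<alpha> a \<in> Lm" "a \<in> Lm \<Longrightarrow> \<beta> a \<in> Lm" for a
    using ab by (auto simp: abelian_bihom_subalgebra_def bihom_subalgebra_def)
  obtain a b where "a \<in> Lp" "a \<noteq> 0" "b \<in> Lm" "b \<noteq> 0"
    using nz zero by blast
  \<comment> \<open>As \<open>E a = a\<close> and \<open>E b = - b\<close>, either equality would
    make a nonzero vector its own negative.\<close>
  then have "E a \<noteq> - a" "E b \<noteq> b"
    using Ep Em eq_uminus_iff_eq_0[OF two] by (metis, metis)
  then have not_id: "E \<noteq> id" "E \<noteq> (\<lambda>x. - x)" by auto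
  have "E (E x) = x \<and> \<alpha> (E x) = E (\<alpha> x) \<and> \<beta> (E x) = E (\<beta> x)" for x
  proof -
    obtain a b where x: "a \<in> Lp" "b \<in> Lm" "x = a + b" by (rule direct_sum_obtain[OF ds])
    then show ?thesis
      by (simp add: E_hom Ep Em closed linear_hom_add[OF linear_\<alpha>] linear_hom_diff[OF linear_\<alpha>]
        linear_hom_add[OF linear_\<beta>] linear_hom_diff[OF linear_\<beta>])
  qed
  with lin not_id have "almost_product_structure scale \<alpha> \<beta> E"
    by (auto simp: almost_product_structure_def)
  moreover have "br x y z = E (br (E x) y z) + E (br x (E y) z) + E (br x y (E z))" for x y z
  proof -
    \<comment> \<open>Expanding three sums gives eight brackets: two with equal signs, which vanish,
      and six mixed ones, on which \<open>E\<close> acts by the majority sign.\<close>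
    have br_0: "br u v w = 0" if "u \<in> Lp \<and> v \<in> Lp \<and> w \<in> Lp \<or> u \<in> Lm \<and> v \<in> Lm \<and> w \<in> Lm" for u v w
      using ab that by (auto simp: abelian_bihom_subalgebra_def)
    have br_p: "E (br u v w) = br u v w"
      if "u \<in> Lp \<and> v \<in> Lp \<and> w \<in> Lm \<or> u \<in> Lp \<and> v \<in> Lm \<and> w \<in> Lp \<or> u \<in> Lm \<and> v \<in> Lp \<and> w \<in> Lp" for u v w
      using incl(1-3) that by (intro Ep) (auto simp: bracket_span_subset_iff sub)
    have br_m: "E (br u v w) = - br u v w"
      if "u \<in> Lm \<and> v \<in> Lp \<and> w \<in> Lm \<or> u \<in> Lp \<and> v \<in> Lm \<and> w \<in> Lm \<or> u \<in> Lm \<and> v \<in> Lm \<and> w \<in> Lp" for u v w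
      using incl(4-6) that by (intro Em) (auto simp: bracket_span_subset_iff sub)
    obtain a b where x: "a \<in> Lp" "b \<in> Lm" "x = a + b" by (rule direct_sum_obtain[OF ds])
    obtain c d where y: "c \<in> Lp" "d \<in> Lm" "y = c + d" by (rule direct_sum_obtain[OF ds])
    obtain e f where z: "e \<in> Lp" "f \<in> Lm" "z = e + f" by (rule direct_sum_obtain[OF ds])
    show ?thesis
      using x y z by (simp add: Ep Em br_add br_diff br_uminus E_hom br_0 br_p br_m)
  qed
  ultimately show ?thesis unfolding strong_abelian_product_structure_def by blast
qed

end

text \<open>Nonzero summands correspond to \<open>E\<close> being neither \<open>id\<close> nor its
  negative. In characteristic 2 the eigenvalues \<open>1\<close> and \<open>-1\<close> coincide, so
  the eigenspaces would not give a splitting.\<close>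

theorem corollary3p13:
  fixes scale :: "'k::field \<Rightarrow> 'v::ab_group_add \<Rightarrow> 'v"
    and br :: "'v \<Rightarrow> 'v \<Rightarrow> 'v \<Rightarrow> 'v"
    and \<alpha> \<beta> :: "'v \<Rightarrow> 'v"
  assumes "three_bihom_lie_algebra scale br \<alpha> \<beta>"
    and char_not_2: "(2::'k) \<noteq> 0"
  shows "(\<exists>E. strong_abelian_product_structure scale br \<alpha> \<beta> E) \<longleftrightarrow>
    (\<exists>Lp Lm. direct_sum_decomposition scale Lp Lm \<and> Lp \<noteq> {0} \<and> Lm \<noteq> {0} \<and>
       abelian_bihom_subalgebra scale br \<alpha> \<beta> Lp \<and>
       abelian_bihom_subalgebra scale br \<alpha> \<beta> Lm \<and>
       bracket_span scale br Lp Lp Lm \<subseteq> Lp \<and>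
       bracket_span scale br Lp Lm Lp \<subseteq> Lp \<and>
       bracket_span scale br Lm Lp Lp \<subseteq> Lp \<and>
       bracket_span scale br Lm Lp Lm \<subseteq> Lm \<and>
       bracket_span scale br Lp Lm Lm \<subseteq> Lm \<and>
       bracket_span scale br Lm Lm Lp \<subseteq> Lm)"
proof -
  interpret three_bihom_lie_algebra scale br \<alpha> \<beta> by fact
  show ?thesis (is "_ \<longleftrightarrow> ?decomposition")
  proof
    assume "\<exists>E. strong_abelian_product_structure scale br \<alpha> \<beta> E"
    then obtain E where "strong_abelian_product_structure scale br \<alpha> \<beta> E" ..
    note strong_abelian_product_structure_imp_decomposition[OF char_not_2 this]
    then show ?decomposition by blast
  next
    assume ?decomposition
    then show "\<exists>E. strong_abelian_product_structure scale br \<alpha> \<beta> E"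
      using decomposition_imp_strong_abelian_product_structure[OF char_not_2] by blast
  qed
qed

end
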